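(* Let $G$ and $H$ be finite additive groups. If there exist a Fano Kaleidoscopic Difference Family FKDF$(G)$, a Fano Kaleidoscopic Difference Family FKDF$(H)$, and an $(H,7,1)$ difference matrix, then there exists a Fano Kaleidoscopic Difference Family FKDF$(G\times H)$.
   Context: For a subset $B$ of an additive group $G$, $\Delta B$ is the multiset of differences $x-y$ over ordered pairs of distinct $x,y\in B$. A $(G,k,\lambda)$ difference family is a collection of $k$-subsets of $G$ whose difference lists together cover each nonzero element of $G$ exactly $\lambda$ times. For an ordered 7-tuple $B=(b_0,\dots,b_6)$, its $i$-th line is $\ell_i(B)=\{b_i,b_{i+1},b_{i+3}\}$ (indices mod 7). An FKDF$(G)$ is a $(G,7,7)$ difference family together with an ordering of the points of each block such that for each $j\in\{0,\dots,6\}$ the set of $j$-th lines of all its blocks is a $(G,3,1)$ difference family. An $(H,k,1)$ difference matrix is a $k\times|H|$ matrix with entries in $H$ such that the difference of any two distinct rows contains each element of $H$ exactly once. *)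

theory Defs
  imports Main "HOL-Library.Cardinality" "HOL-Library.Multiset" "HOL-Library.Product_Plus"
begin

text \<open>
  Class \<open>group_add\<close> is the class of additively written groups, not necessarily commutative, in
  which \<open>x - y = x + (- y)\<close>. A finite additive group is a type of sort \<open>{finite, group_add}\<close>,
  and \<open>G \<times> H\<close> is the product type with the componentwise structure of \<open>Product_Plus\<close>.
\<close>

definition differences :: "'a::{finite,group_add} set \<Rightarrow> 'a multiset" where
  "differences B =
     image_mset (\<lambda>(x, y). x - y) (mset_set {(x, y). x \<in> B \<and> y \<in> B \<and> x \<noteq> y})"

text \<open>A family of blocks is a multiset, so repeated blocks count with multiplicity.\<close>

definition difference_family :: "nat \<Rightarrow> nat \<Rightarrow> 'a::{finite,group_add} set multiset \<Rightarrow> bool" where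
  "difference_family k l F \<longleftrightarrow>
     (\<forall>B \<in># F. card B = k) \<and>
     (\<forall>g. g \<noteq> 0 \<longrightarrow> count (\<Sum>B \<in># F. differences B) g = l)"

definition fano_line :: "nat \<Rightarrow> 'a list \<Rightarrow> 'a set" where
  "fano_line i B = {B ! (i mod 7), B ! ((i + 1) mod 7), B ! ((i + 3) mod 7)}"

text \<open>
  A block together with an ordering of its points is a distinct list, the block being its
  underlying set.
\<close>

definition FKDF :: "'a::{finite,group_add} list multiset \<Rightarrow> bool" where
  "FKDF F \<longleftrightarrow>
     (\<forall>B \<in># F. length B = 7 \<and> distinct B) \<and>
     difference_family 7 7 (image_mset set F) \<and>
     (\<forall>j < 7. difference_family 3 1 (image_mset (fano_line j) F))"

text \<open>Only the entries with row index below \<open>k\<close> and column index below the group order matter.\<close>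

definition difference_matrix :: "nat \<Rightarrow> (nat \<Rightarrow> nat \<Rightarrow> 'a::{finite,group_add}) \<Rightarrow> bool" where
  "difference_matrix k M \<longleftrightarrow>
     (\<forall>i < k. \<forall>j < k. i \<noteq> j \<longrightarrow> (\<forall>h. \<exists>!c. c < CARD('a) \<and> M i c - M j c = h))"

end

theory Submission
  imports Defs
begin

text \<open>
  Each block \<open>(b\<^sub>0, \<dots>, b\<^sub>6)\<close> over \<open>G\<close> is lifted, for every column \<open>c\<close> of the difference
  matrix \<open>M\<close>, to \<open>((b\<^sub>0, M 0 c), \<dots>, (b\<^sub>6, M 6 c))\<close>, and each block over \<open>H\<close> is embedded into
  \<open>{0} \<times> H\<close>. For fixed positions \<open>i \<noteq> k\<close> the differences \<open>M i c - M k c\<close> run once through \<open>H\<close>,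
  so the lifts cover each \<open>(g, h)\<close> exactly as often as the given family covers \<open>g\<close>; since the
  points of a block are distinct, this yields the elements with \<open>g \<noteq> 0\<close>, and the embedded blocks
  yield those with \<open>g = 0\<close>. The argument applies to any set of positions, in particular to
  the whole block and to each of its lines.
\<close>

text \<open>Recording positions instead of points makes the index set independent of the block, so
  that a block and its lifts can be compared pair by pair.\<close>

definition difference_pairs :: "nat set \<Rightarrow> 'a::group_add list \<Rightarrow> 'a \<Rightarrow> (nat \<times> nat) set" where
  "difference_pairs I B g = {(i, k). i \<in> I \<and> k \<in> I \<and> i \<noteq> k \<and> B ! i - B ! k = g}"

lemma finite_difference_pairs: "finite I \<Longrightarrow> finite (difference_pairs I B g)"
  by (rule finite_subset[of _ "I \<times> I"]) (auto simp: difference_pairs_def)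

lemma inj_on_nth_positions:
  assumes "distinct B" "I \<subseteq> {..<length B}"
  shows "inj_on ((!) B) I"
  using assms by (auto intro!: inj_on_nth)

text \<open>In a distinct list positions and points correspond bijectively, so each ordered pair of
  distinct points with difference \<open>g\<close> comes from exactly one pair of positions.\<close>

lemma count_differences_positions:
  fixes B :: "'a::{finite,group_add} list"
  assumes "distinct B" "I \<subseteq> {..<length B}"
  shows "count (differences ((!) B ` I)) g = card (difference_pairs I B g)"
proof -
  have inj: "inj_on ((!) B) I"
    using assms by (rule inj_on_nth_positions)
  let ?f = "\<lambda>(i, k). (B ! i, B ! k)"
  have "count (differences ((!) B ` I)) g
      = card {p \<in> {(x, y). x \<in> (!) B ` I \<and> y \<in> (!) B ` I \<and> x \<noteq> y}. case p of (x, y) \<Rightarrow> x - y = g}"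
    unfolding differences_def count_image_mset
    by (simp add: count_mset_set' sum.If_cases vimage_def)
       (rule arg_cong[where f = card], auto)
  also have "\<dots> = card (?f ` difference_pairs I B g)"
  proof (rule arg_cong[where f = card])
    have "B ! i \<noteq> B ! k" if "i \<in> I" "k \<in> I" "i \<noteq> k" for i k
      using inj that by (auto dest: inj_onD)
    then show "{p \<in> {(x, y). x \<in> (!) B ` I \<and> y \<in> (!) B ` I \<and> x \<noteq> y}.
        case p of (x, y) \<Rightarrow> x - y = g} = ?f ` difference_pairs I B g"
      unfolding difference_pairs_def by (auto simp: image_iff Bex_def split: prod.splits) metis
  qed
  also have "\<dots> = card (difference_pairs I B g)"
    by (rule card_image) (use inj in \<open>auto simp: difference_pairs_def inj_on_def\<close>)
  finally show ?thesis .
qed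

lemma count_sum_mset: "count (\<Sum>x \<in># A. f x) g = (\<Sum>x \<in># A. count (f x) g)"
  by (induction A) auto

text \<open>This reduces the design condition to counting position pairs. The size condition stays
  under the quantifier over \<open>F\<close> because an empty family satisfies it for every
  \<open>k\<close>.\<close>

lemma difference_family_positions_iff:
  fixes F :: "'a::{finite,group_add} list multiset"
  assumes "\<And>B. B \<in># F \<Longrightarrow> length B = n \<and> distinct B" "I \<subseteq> {..<n}"
  shows "difference_family k l (image_mset (\<lambda>B. (!) B ` I) F) \<longleftrightarrow>
    (\<forall>B \<in># F. card I = k) \<and> (\<forall>g. g \<noteq> 0 \<longrightarrow> (\<Sum>B \<in># F. card (difference_pairs I B g)) = l)"
proof -
  have "card ((!) B ` I) = card I" if "B \<in># F" for B
    using assms that by (intro card_image inj_on_nth_positions) auto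
  moreover have "(\<Sum>B \<in># F. count (differences ((!) B ` I)) g)
      = (\<Sum>B \<in># F. card (difference_pairs I B g))" for g
    using assms
    by (intro arg_cong[where f = sum_mset] image_mset_cong) (simp add: count_differences_positions)
  ultimately show ?thesis
    by (simp add: difference_family_def count_sum_mset image_mset.compositionality comp_def)
qed

definition lift_block :: "nat \<Rightarrow> (nat \<Rightarrow> nat \<Rightarrow> 'h) \<Rightarrow> 'g list \<Rightarrow> nat \<Rightarrow> ('g \<times> 'h) list" where
  "lift_block n M B c = map (\<lambda>i. (B ! i, M i c)) [0..<n]"

definition product_family ::
    "nat \<Rightarrow> (nat \<Rightarrow> nat \<Rightarrow> 'h::{finite,group_add}) \<Rightarrow> 'g::{finite,group_add} list multiset \<Rightarrow>
     'h list multiset \<Rightarrow> ('g \<times> 'h) list multiset" where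
  "product_family n M F E =
     (\<Sum>B \<in># F. image_mset (lift_block n M B) (mset_set {..<CARD('h)})) +
     image_mset (map (Pair 0)) E"

lemma sum_mset_image_sum_mset:
  "(\<Sum>y \<in># (\<Sum>x \<in># A. f x). g y) = (\<Sum>x \<in># A. \<Sum>y \<in># f x. (g y :: 'a::comm_monoid_add))"
  by (induction A) auto

lemma sum_card_difference_pairs_lift_block:
  fixes M :: "nat \<Rightarrow> nat \<Rightarrow> 'h::{finite,group_add}" and B :: "'g::group_add list"
  assumes M: "difference_matrix n M" and I: "I \<subseteq> {..<n}"
  shows "(\<Sum>c < CARD('h). card (difference_pairs I (lift_block n M B c) (g, h)))
    = card (difference_pairs I B g)"
proof -
  have fin: "finite I"
    using I finite_subset by blast
  \<comment> \<open>Double counting: \<open>?S\<close> collects the columns together with their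
    position pairs, and \<open>snd\<close> forgets the column.\<close>
  let ?S = "SIGMA c:{..<CARD('h)}. difference_pairs I (lift_block n M B c) (g, h)"
  have pairs: "difference_pairs I (lift_block n M B c) (g, h)
      = {(i, k) \<in> difference_pairs I B g. M i c - M k c = h}" for c
    using I by (auto simp: difference_pairs_def lift_block_def subset_eq)
  have "(\<Sum>c < CARD('h). card (difference_pairs I (lift_block n M B c) (g, h))) = card ?S"
    by (simp add: finite_difference_pairs[OF fin])
  also have "\<dots> = card (difference_pairs I B g)"
  proof (rule bij_betw_same_card)
    have unique: "\<exists>!c. c < CARD('h) \<and> M i c - M k c = h"
      if "(i, k) \<in> difference_pairs I B g" for i k
      using M I that unfolding difference_matrix_def difference_pairs_def by blast
    \<comment> \<open>Uniqueness of the column with \<open>M i c - M k c = h\<close> gives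
      injectivity; its existence gives surjectivity below.\<close>
    have "inj_on snd ?S"
      unfolding pairs by (intro inj_onI, clarsimp) (metis unique)
    moreover have "snd ` ?S = difference_pairs I B g"
    proof (intro equalityI subsetI)
      fix p assume "p \<in> difference_pairs I B g"
      moreover obtain i k where p: "p = (i, k)"
        by fastforce
      ultimately obtain c where "c < CARD('h)" "M i c - M k c = h"
        using unique by blast
      then have "(c, p) \<in> ?S"
        using \<open>p \<in> difference_pairs I B g\<close> by (simp add: pairs p)
      then show "p \<in> snd ` ?S"
        by force
    qed (auto simp: pairs)
    ultimately show "bij_betw snd ?S (difference_pairs I B g)"
      by (simp add: bij_betw_def)
  qed
  finally show ?thesis .
qed

text \<open>Consequently the lifts contribute nothing to the elements \<open>(0, h)\<close>, which
  are left to the embedded blocks.\<close>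

lemma difference_pairs_zero:
  assumes "distinct B" "I \<subseteq> {..<length B}"
  shows "difference_pairs I B 0 = {}"
  using inj_on_nth_positions[OF assms] by (auto simp: difference_pairs_def inj_on_def)

lemma difference_pairs_map_Pair_zero:
  assumes "I \<subseteq> {..<length B}"
  shows "difference_pairs I (map (Pair 0) B) (g, h)
    = (if g = 0 then difference_pairs I B h else {})"
  using assms by (auto simp: difference_pairs_def subset_eq)

lemma in_product_family:
  fixes M :: "nat \<Rightarrow> nat \<Rightarrow> 'h::{finite,group_add}"
  shows "C \<in># product_family n M F E \<longleftrightarrow>
    (\<exists>B c. B \<in># F \<and> c < CARD('h) \<and> C = lift_block n M B c) \<or> (\<exists>B. B \<in># E \<and> C = map (Pair 0) B)"
  by (auto simp: product_family_def)

lemma product_family_distinct: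
  assumes "\<And>B. B \<in># F \<Longrightarrow> length B = n \<and> distinct B"
    and "\<And>B. B \<in># E \<Longrightarrow> length B = n \<and> distinct B"
    and "C \<in># product_family n M F E"
  shows "length C = n \<and> distinct C"
  using assms
  by (auto simp: in_product_family lift_block_def distinct_map inj_on_def nth_eq_iff_index_eq)

lemma difference_family_product_family:
  fixes M :: "nat \<Rightarrow> nat \<Rightarrow> 'h::{finite,group_add}" and F :: "'g::{finite,group_add} list multiset"
  assumes F: "\<And>B. B \<in># F \<Longrightarrow> length B = n \<and> distinct B"
    and E: "\<And>B. B \<in># E \<Longrightarrow> length B = n \<and> distinct B"
    and M: "difference_matrix n M" and I: "I \<subseteq> {..<n}"
    and dF: "difference_family k l (image_mset (\<lambda>B. (!) B ` I) F)"
    and dE: "difference_family k l (image_mset (\<lambda>B. (!) B ` I) E)"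
  shows "difference_family k l (image_mset (\<lambda>B. (!) B ` I) (product_family n M F E))"
proof -
  have sumF: "\<And>g. g \<noteq> 0 \<Longrightarrow> (\<Sum>B \<in># F. card (difference_pairs I B g)) = l"
    and cardF: "\<And>B. B \<in># F \<Longrightarrow> card I = k"
    using dF difference_family_positions_iff[OF F I] by blast+
  have sumE: "\<And>g. g \<noteq> 0 \<Longrightarrow> (\<Sum>B \<in># E. card (difference_pairs I B g)) = l"
    and cardE: "\<And>B. B \<in># E \<Longrightarrow> card I = k"
    using dE difference_family_positions_iff[OF E I] by blast+
  have lift: "(\<Sum>B \<in># (\<Sum>B \<in># F. image_mset (lift_block n M B) (mset_set {..<CARD('h)})).
        card (difference_pairs I B (g, h))) = (\<Sum>B \<in># F. card (difference_pairs I B g))" for g h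
    unfolding sum_mset_image_sum_mset
    by (simp add: image_mset.compositionality comp_def sum_card_difference_pairs_lift_block[OF M I]
        flip: sum_unfold_sum_mset)
  have embed: "(\<Sum>B \<in># image_mset (map (Pair 0)) E. card (difference_pairs I B (g, h)))
      = (if g = 0 then \<Sum>B \<in># E. card (difference_pairs I B h) else 0)" for g :: 'g and h
  proof -
    have "(\<Sum>B \<in># image_mset (map (Pair 0)) E. card (difference_pairs I B (g, h)))
        = (\<Sum>B \<in># E. if g = 0 then card (difference_pairs I B h) else 0)"
      unfolding image_mset.compositionality comp_def
      by (intro arg_cong[where f = sum_mset] image_mset_cong)
         (use E I in \<open>simp add: difference_pairs_map_Pair_zero\<close>)
    then show ?thesis
      by simp
  qed
  have zero: "(\<Sum>B \<in># F. card (difference_pairs I B 0)) = 0"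
    using F I by (simp add: difference_pairs_zero)
  have "(\<Sum>B \<in># product_family n M F E. card (difference_pairs I B p)) = l" if "p \<noteq> 0" for p
  proof -
    obtain g h where p: "p = (g, h)"
      by fastforce
    have "(\<Sum>B \<in># product_family n M F E. card (difference_pairs I B p))
        = (\<Sum>B \<in># F. card (difference_pairs I B g)) +
          (if g = 0 then \<Sum>B \<in># E. card (difference_pairs I B h) else 0)"
      unfolding p product_family_def image_mset_union sum_mset.union lift embed ..
    \<comment> \<open>If \<open>g = 0\<close>, the first sum vanishes by \<open>zero\<close>, and
      \<open>h\<close> is nonzero since \<open>p\<close> is, so \<open>sumE\<close> applies.
      Otherwise the second summand is \<open>0\<close> and \<open>sumF\<close> applies.\<close>
    also have "\<dots> = l"
      using that zero sumF sumE by (cases "g = 0") (auto simp: p zero_prod_def)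
    finally show ?thesis .
  qed
  \<comment> \<open>Either family may be empty, so the size is taken from the one in which
    \<open>C\<close> originates.\<close>
  moreover have "card I = k" if "C \<in># product_family n M F E" for C
    using that cardF cardE unfolding in_product_family by blast
  ultimately show ?thesis
    by (subst difference_family_positions_iff[OF product_family_distinct[OF F E] I]) auto
qed

text \<open>These are the translates of the difference set {0, 1, 3} modulo 7, that is, the lines of
  the Fano plane.\<close>

definition fano_positions :: "nat \<Rightarrow> nat set" where
  "fano_positions j = {j mod 7, (j + 1) mod 7, (j + 3) mod 7}"

lemma fano_line_positions: "fano_line j = (\<lambda>B. (!) B ` fano_positions j)"
  by (auto simp: fano_line_def fano_positions_def)

text \<open>Whole blocks and lines become instances of one scheme, images of a fixed set of
  positions, so a single lemma treats all eight conditions. Rewriting \<open>set\<close> as the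
  image of \<open>{..<7}\<close> relies on the blocks having length 7.\<close>

lemma FKDF_positions_iff:
  "FKDF F \<longleftrightarrow>
     (\<forall>B \<in># F. length B = 7 \<and> distinct B) \<and>
     difference_family 7 7 (image_mset (\<lambda>B. (!) B ` {..<7}) F) \<and>
     (\<forall>j < 7. difference_family 3 1 (image_mset (\<lambda>B. (!) B ` fano_positions j) F))"
proof -
  have "image_mset set F = image_mset (\<lambda>B. (!) B ` {..<7}) F"
    if "\<forall>B \<in># F. length B = 7 \<and> distinct B"
    using that by (intro image_mset_cong) (auto simp: set_conv_nth)
  then show ?thesis
    unfolding FKDF_def fano_line_positions by auto
qed

theorem theorem8:
  assumes "\<exists>F :: 'g::{finite,group_add} list multiset. FKDF F"
    and "\<exists>F :: 'h::{finite,group_add} list multiset. FKDF F"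
    and "\<exists>M :: nat \<Rightarrow> nat \<Rightarrow> 'h. difference_matrix 7 M"
  shows "\<exists>F :: ('g \<times> 'h) list multiset. FKDF F"
proof -
  obtain F :: "'g list multiset" and E :: "'h list multiset" and M :: "nat \<Rightarrow> nat \<Rightarrow> 'h"
    where F: "FKDF F" and E: "FKDF E" and M: "difference_matrix 7 M"
    using assms by blast
  have blocks: "\<And>B. B \<in># F \<Longrightarrow> length B = 7 \<and> distinct B" "\<And>B. B \<in># E \<Longrightarrow> length B = 7 \<and> distinct B"
    using F E by (auto simp: FKDF_def)
  have "FKDF (product_family 7 M F E)"
    unfolding FKDF_positions_iff
  proof (intro conjI ballI allI impI)
    fix j :: nat assume "j < 7"
    moreover have "fano_positions j \<subseteq> {..<7}"
      by (auto simp: fano_positions_def)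
    ultimately show "difference_family 3 1
        (image_mset (\<lambda>B. (!) B ` fano_positions j) (product_family 7 M F E))"
      using F E by (intro difference_family_product_family blocks M) (auto simp: FKDF_positions_iff)
  next
    show "difference_family 7 7 (image_mset (\<lambda>B. (!) B ` {..<7}) (product_family 7 M F E))"
      using F E by (intro difference_family_product_family blocks M) (auto simp: FKDF_positions_iff)
  qed (use product_family_distinct[OF blocks] in blast)+
  then show ?thesis ..
qed

end
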